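(* For all integers $n\ge 3$ and $d\ge 3$, $\gamma_d(n)\ge d(n-2)$.
   Context: $\mathbb{N}$ denotes the positive integers. For a finite set $A$, $O_A$ is the set of all finitary operations $A^m\to A$ ($m\in\mathbb{N}$); for $F\subseteq O_A$, $F^{(m)}$ is the set of $m$-ary operations in $F$. A set $F\subseteq O_A$ is a clone on $A$ if it contains all projections and is closed under composition: for $f\in F^{(m)}$ and $g_1,\dots,g_m\in F^{(m')}$, the operation $f(g_1,\dots,g_m)(x_1,\dots,x_{m'}) := f(g_1(x_1,\dots,x_{m'}),\dots,g_m(x_1,\dots,x_{m'}))$ is in $F$. $\mathrm{Clo}(F)$ is the smallest clone containing $F$. For $d\ge 2$, an operation $g\colon A^{d+1}\to A$ is a near-unanimity operation if for all $x,y\in A$: $g(x,\dots,x,y)=g(x,\dots,x,y,x)=\dots=g(y,x,\dots,x)=x$. It is conservative if $g(x_1,\dots,x_{d+1})\in\{x_1,\dots,x_{d+1}\}$ for all $x_1,\dots,x_{d+1}\in A$. For a clone $C$ on a finite set containing a near-unanimity operation, $\lambda(C):=\min\{m\in\mathbb{N}\mid C=\mathrm{Clo}(C^{(m)})\}$ (this exists by the Baker–Pixley theorem). For $d\ge2$, $n\ge 2$, let $\mathcal{C}^d_n$ be the set of all clones on $\{0,\dots,n-1\}$ that contain a $(d+1)$-ary conservative near-unanimity operation (a finite set, as a consequence of the Baker–Pixley theorem), and $\gamma_d(n):=\max\{\lambda(C)\mid C\in\mathcal{C}^d_n\}$. *)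

theory Defs
  imports Main "HOL-Library.FuncSet" "HOL-Library.NList"
begin

text \<open>
  An \<open>m\<close>-ary operation on \<open>A\<close> is a pair \<open>(m, f)\<close>, where \<open>f\<close> acts on the lists of length \<open>m\<close>
  over \<open>A\<close> and is \<^const>\<open>undefined\<close> elsewhere. Extensionality makes equality of operations on
  \<open>A\<close> the equality of pairs; the arity is kept since it cannot always be recovered from \<open>f\<close>.
\<close>

type_synonym 'a operation = "nat \<times> ('a list \<Rightarrow> 'a)"

definition operations :: "'a set \<Rightarrow> 'a operation set" where
  "operations A = {(m, f). 1 \<le> m \<and> f \<in> nlists m A \<rightarrow>\<^sub>E A}"

definition arity_part :: "'a operation set \<Rightarrow> nat \<Rightarrow> 'a operation set" where
  "arity_part F m = {p \<in> F. fst p = m}"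

definition projection :: "'a set \<Rightarrow> nat \<Rightarrow> nat \<Rightarrow> 'a operation" where
  "projection A m i = (m, \<lambda>xs\<in>nlists m A. xs ! i)"

definition composition ::
    "'a set \<Rightarrow> nat \<Rightarrow> ('a list \<Rightarrow> 'a) \<Rightarrow> ('a list \<Rightarrow> 'a) list \<Rightarrow> 'a operation" where
  "composition A k f gs = (k, \<lambda>xs\<in>nlists k A. f (map (\<lambda>g. g xs) gs))"

definition is_clone :: "'a set \<Rightarrow> 'a operation set \<Rightarrow> bool" where
  "is_clone A F \<longleftrightarrow>
     F \<subseteq> operations A \<and>
     (\<forall>m i. i < m \<longrightarrow> projection A m i \<in> F) \<and>
     (\<forall>m k f gs. (m, f) \<in> F \<and> length gs = m \<and> (\<forall>g\<in>set gs. (k, g) \<in> F)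
        \<longrightarrow> composition A k f gs \<in> F)"

definition Clo :: "'a set \<Rightarrow> 'a operation set \<Rightarrow> 'a operation set" where
  "Clo A F = \<Inter>{C. is_clone A C \<and> F \<subseteq> C}"

definition near_unanimity :: "'a set \<Rightarrow> nat \<Rightarrow> ('a list \<Rightarrow> 'a) \<Rightarrow> bool" where
  "near_unanimity A d g \<longleftrightarrow>
     (d + 1, g) \<in> operations A \<and>
     (\<forall>x\<in>A. \<forall>y\<in>A. \<forall>i<d + 1. g ((replicate (d + 1) x)[i := y]) = x)"

definition conservative :: "'a set \<Rightarrow> 'a operation \<Rightarrow> bool" where
  "conservative A p \<longleftrightarrow> (\<forall>xs\<in>nlists (fst p) A. snd p xs \<in> set xs)"

text \<open>
  By the Baker--Pixley theorem, the minimum is over a nonempty set if \<open>A\<close> is finite and \<open>C\<close> is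
  a clone on \<open>A\<close> with a near-unanimity operation, and the maximum in \<open>gamma\<close> below is over a
  finite nonempty set if \<open>d \<ge> 2\<close> and \<open>n \<ge> 2\<close>.
\<close>

definition clone_lambda :: "'a set \<Rightarrow> 'a operation set \<Rightarrow> nat" where
  "clone_lambda A C = (LEAST m. 1 \<le> m \<and> C = Clo A (arity_part C m))"

definition cons_nu_clones :: "nat \<Rightarrow> nat \<Rightarrow> nat operation set set" where
  "cons_nu_clones d n =
     {C. is_clone {..<n} C \<and>
         (\<exists>g. (d + 1, g) \<in> C \<and> near_unanimity {..<n} d g \<and> conservative {..<n} (d + 1, g))}"

definition gamma :: "nat \<Rightarrow> nat \<Rightarrow> nat" where
  "gamma d n = Max {clone_lambda {..<n} C | C. C \<in> cons_nu_clones d n}"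

end

theory Submission imports Defs begin

text \<open>
  The maximum that defines \<^const>\<open>gamma\<close> is over a bounded set, and every clone in question is
  generated by its operations of some arity, by the Baker--Pixley argument: an operation that agrees
  with some member of a clone on every set of at most \<open>d\<close> arguments belongs to the clone once a
  \<open>(d + 1)\<close>-ary near-unanimity operation is available (\<open>baker_pixley\<close>). On \<open>d\<close> arguments over a
  finite set \<open>A\<close>, at most \<open>card A ^ d\<close> variables of an operation can be told apart, so that the
  operations of arity \<open>d + 1 + card A ^ d\<close> generate (\<open>generated_by_arity_part\<close>).

  The lower bound comes from one clone. Put \<open>q = n - 2\<close> and \<open>N = d * q\<close>. The \<open>N\<close> \<^emph>\<open>spikes\<close> are
  the \<open>d\<close>-tuples with one entry among \<open>2, \<dots>, n - 1\<close> and all other entries \<open>0\<close>. For a set \<open>K\<close> of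
  spikes let \<open>R K\<close> (\<open>spike_rel\<close> below) consist of \<open>K\<close> and of all \<open>0\<close>-\<open>1\<close>-tuples except
  \<open>(1, \<dots>, 1)\<close>. Let \<open>C\<close> be the clone (\<open>spike_clone\<close>) of all operations that preserve \<open>R K\<close> for
  each \<open>K\<close> that omits exactly one spike.

  An operation in \<open>C\<close> of arity less than \<open>N\<close> preserves \<open>R K\<close> for the set \<open>K\<close> of all spikes too, because
  any of its argument lists omits some spike (\<open>preserves_all_spikes\<close>). Hence so does every operation
  generated by these. However, \<open>C\<close> contains an \<open>N\<close>-ary operation that maps the list of all spikes
  to \<open>(1, \<dots>, 1)\<close>: it is \<open>1\<close> on the \<open>d\<close> rows of the matrix whose columns are the spikes, and \<open>0\<close>
  elsewhere (\<open>witness_op_preserves\<close>). Finally, \<open>C\<close> contains a conservative near-unanimity operation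
  (\<open>cons_nu_preserves\<close>), where pigeonhole on the zeros of \<open>d + 1\<close> tuples of length \<open>d\<close> excludes the
  value \<open>(1, \<dots>, 1)\<close>.
\<close>

section \<open>Clones and invariant relations\<close>

(* As rewrite rules, these two make the simplifier look for an arity and a carrier set of every
   list that occurs, which is slow in the presence of operations applied to mapped lists. *)
declare nlistsE_length [simp del] nlistsE_set [simp del]

lemma in_nlists_iff: "xs \<in> nlists m A \<longleftrightarrow> length xs = m \<and> set xs \<subseteq> A"
  by (simp add: nlists_def)

lemma finite_nlists: "finite A \<Longrightarrow> finite (nlists m A)"
  using finite_lists_length_eq[of A m] by (simp add: nlists_def conj_commute)

lemma projection_in_clone: "is_clone A C \<Longrightarrow> i < m \<Longrightarrow> projection A m i \<in> C"
  by (simp add: is_clone_def)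

lemma composition_in_clone:
  "is_clone A C \<Longrightarrow> (m, f) \<in> C \<Longrightarrow> length gs = m \<Longrightarrow> (\<And>g. g \<in> set gs \<Longrightarrow> (k, g) \<in> C) \<Longrightarrow>
    composition A k f gs \<in> C"
  unfolding is_clone_def by blast

lemma clone_operationD:
  assumes "is_clone A C" "(m, f) \<in> C"
  shows "1 \<le> m" "f \<in> nlists m A \<rightarrow>\<^sub>E A"
  using assms by (auto simp: is_clone_def operations_def)

lemma is_clone_operations: "is_clone A (operations A)"
proof -
  have "projection A m i \<in> operations A" if "i < m" for m i
  proof -
    have "xs ! i \<in> A" if "xs \<in> nlists m A" for xs
      using that \<open>i < m\<close> by (rule nlistsE_nth_in)
    then show ?thesis using that by (simp add: projection_def operations_def)
  qed
  moreover have "composition A k f gs \<in> operations A"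
    if f: "(m, f) \<in> operations A" and l: "length gs = m"
      and g: "\<forall>g\<in>set gs. (k, g) \<in> operations A" for m k f gs
  proof -
    have "gs \<noteq> []" using f l by (auto simp: operations_def)
    then have "1 \<le> k" using g by (cases gs) (auto simp: operations_def)
    moreover have "f (map (\<lambda>g. g xs) gs) \<in> A" if "xs \<in> nlists k A" for xs
    proof -
      have "(\<lambda>g. g xs) ` set gs \<subseteq> A"
        using g that by (intro image_subsetI) (auto simp: operations_def)
      then have "map (\<lambda>g. g xs) gs \<in> nlists m A"
        using l by (simp add: in_nlists_iff)
      then show ?thesis using f by (auto simp: operations_def)
    qed
    ultimately show ?thesis by (auto simp: composition_def operations_def)
  qed
  ultimately show ?thesis unfolding is_clone_def by blast
qed

lemma Clo_is_clone:
  assumes "F \<subseteq> operations A"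
  shows "is_clone A (Clo A F)"
proof -
  have "Clo A F \<subseteq> operations A"
    using assms is_clone_operations by (auto simp: Clo_def)
  moreover have "projection A m i \<in> Clo A F" if "i < m" for m i
    using that by (auto simp: Clo_def intro: projection_in_clone)
  moreover have "composition A k f gs \<in> Clo A F"
    if "(m, f) \<in> Clo A F" "length gs = m" "\<forall>g\<in>set gs. (k, g) \<in> Clo A F" for m k f gs
    unfolding Clo_def
  proof (rule InterI)
    fix C assume "C \<in> {C. is_clone A C \<and> F \<subseteq> C}"
    then show "composition A k f gs \<in> C"
      using that by (intro composition_in_clone[of A C m]) (auto simp: Clo_def)
  qed
  ultimately show ?thesis unfolding is_clone_def by blast
qed

lemma Clo_superset: "F \<subseteq> Clo A F"
  by (auto simp: Clo_def)

lemma Clo_least: "is_clone A C \<Longrightarrow> F \<subseteq> C \<Longrightarrow> Clo A F \<subseteq> C"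
  by (auto simp: Clo_def)

text \<open>
  A relation indexed by \<open>I\<close> is a set of functions on \<open>I\<close>. An operation preserves it if its
  coordinatewise application to any list of members is a member.
\<close>

definition preserves :: "'i set \<Rightarrow> 'a operation \<Rightarrow> ('i \<Rightarrow> 'a) set \<Rightarrow> bool" where
  "preserves I p R \<longleftrightarrow>
     (\<forall>ts. length ts = fst p \<and> set ts \<subseteq> R \<longrightarrow> (\<lambda>i\<in>I. snd p (map (\<lambda>t. t i) ts)) \<in> R)"

text \<open>The polymorphisms: the operations that preserve each relation of a given set.\<close>

definition Pol :: "'a set \<Rightarrow> 'i set \<Rightarrow> ('i \<Rightarrow> 'a) set set \<Rightarrow> 'a operation set" where
  "Pol A I Rs = {p \<in> operations A. \<forall>R\<in>Rs. preserves I p R}"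

lemma preservesD:
  "preserves I (m, f) R \<Longrightarrow> length ts = m \<Longrightarrow> set ts \<subseteq> R \<Longrightarrow>
    (\<lambda>i\<in>I. f (map (\<lambda>t. t i) ts)) \<in> R"
  by (simp add: preserves_def)

lemma row_in_nlists:
  assumes "R \<subseteq> I \<rightarrow>\<^sub>E A" "set ts \<subseteq> R" "length ts = m" "i \<in> I"
  shows "map (\<lambda>t. t i) ts \<in> nlists m A"
proof -
  have "(\<lambda>t. t i) ` set ts \<subseteq> A"
    using assms PiE_mem[of _ I "\<lambda>_. A" i] by blast
  then show ?thesis using assms by (simp add: in_nlists_iff)
qed

lemma Pol_is_clone:
  assumes R: "\<And>R. R \<in> Rs \<Longrightarrow> R \<subseteq> I \<rightarrow>\<^sub>E A"
  shows "is_clone A (Pol A I Rs)"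
proof -
  have "projection A m i \<in> Pol A I Rs" if i: "i < m" for m i
  proof -
    have "(\<lambda>j\<in>I. snd (projection A m i) (map (\<lambda>t. t j) ts)) \<in> R"
      if "R \<in> Rs" "length ts = m" "set ts \<subseteq> R" for R ts
    proof -
      have mem: "ts ! i \<in> R" using that i by auto
      have "(\<lambda>j\<in>I. snd (projection A m i) (map (\<lambda>t. t j) ts)) = (\<lambda>j\<in>I. (ts ! i) j)"
      proof (rule restrict_ext)
        fix j assume "j \<in> I"
        then have "map (\<lambda>t. t j) ts \<in> nlists m A"
          using row_in_nlists[OF R[OF that(1)] that(3,2)] by blast
        then show "snd (projection A m i) (map (\<lambda>t. t j) ts) = (ts ! i) j"
          using i that by (simp add: projection_def)
      qed
      also have "\<dots> = ts ! i"
        using mem R[OF \<open>R \<in> Rs\<close>] PiE_restrict[of "ts ! i" I "\<lambda>_. A"] by blast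
      finally show ?thesis using mem by simp
    qed
    moreover have "projection A m i \<in> operations A"
      using i projection_in_clone is_clone_operations by blast
    ultimately show ?thesis by (auto simp: Pol_def preserves_def projection_def)
  qed
  moreover have "composition A k f gs \<in> Pol A I Rs"
    if f: "(m, f) \<in> Pol A I Rs" and l: "length gs = m"
      and g: "\<forall>g\<in>set gs. (k, g) \<in> Pol A I Rs" for m k f gs
  proof -
    have "(\<lambda>j\<in>I. snd (composition A k f gs) (map (\<lambda>t. t j) ts)) \<in> R"
      if "R \<in> Rs" "length ts = k" "set ts \<subseteq> R" for R ts
    proof -
      define us where "us = map (\<lambda>g. \<lambda>i\<in>I. g (map (\<lambda>t. t i) ts)) gs"
      have "set us \<subseteq> R"
        unfolding us_def set_map
        using g \<open>R \<in> Rs\<close> \<open>length ts = k\<close> \<open>set ts \<subseteq> R\<close>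
        by (intro image_subsetI preservesD[of I k]) (auto simp: Pol_def)
      then have mem: "(\<lambda>i\<in>I. f (map (\<lambda>t. t i) us)) \<in> R"
        using f l \<open>R \<in> Rs\<close> by (intro preservesD[of I m]) (auto simp: Pol_def us_def)
      have "(\<lambda>j\<in>I. snd (composition A k f gs) (map (\<lambda>t. t j) ts)) = (\<lambda>i\<in>I. f (map (\<lambda>t. t i) us))"
      proof (rule restrict_ext)
        fix j assume "j \<in> I"
        then have "map (\<lambda>t. t j) ts \<in> nlists k A"
          using row_in_nlists[OF R[OF that(1)] that(3,2)] by blast
        then show "snd (composition A k f gs) (map (\<lambda>t. t j) ts) = f (map (\<lambda>t. t j) us)"
          using \<open>j \<in> I\<close> by (simp add: composition_def us_def comp_def)
      qed
      then show ?thesis using mem by simp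
    qed
    moreover have "composition A k f gs \<in> operations A"
      using f g l by (intro composition_in_clone[OF is_clone_operations, of m]) (auto simp: Pol_def)
    ultimately show ?thesis by (auto simp: Pol_def preserves_def composition_def)
  qed
  ultimately show ?thesis unfolding is_clone_def by (auto simp: Pol_def)
qed

section \<open>The Baker--Pixley bound\<close>

theorem baker_pixley:
  assumes fin: "finite A" and C: "is_clone A C"
    and g: "(d + 1, g) \<in> C" "near_unanimity A d g"
    and f: "(m, f) \<in> operations A"
    and loc: "\<And>X. X \<subseteq> nlists m A \<Longrightarrow> card X \<le> d \<Longrightarrow> \<exists>h. (m, h) \<in> C \<and> (\<forall>x\<in>X. h x = f x)"
  shows "(m, f) \<in> C"
proof -
  have finL: "finite (nlists m A)"
    using fin by (rule finite_nlists)
  have "\<exists>h. (m, h) \<in> C \<and> (\<forall>x\<in>X. h x = f x)" if "X \<subseteq> nlists m A" for X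
    using that
  proof (induction "card X" arbitrary: X rule: less_induct)
    case less
    show ?case
    proof (cases "card X \<le> d")
      case True
      then show ?thesis using loc less.prems by blast
    next
      case False
      have finX: "finite X" using less.prems finL finite_subset by blast
      obtain Y where Y: "Y \<subseteq> X" "card Y = d + 1"
        by (rule obtain_subset_with_card_n[of "d + 1" X]) (use False in simp_all)
      obtain ys where ys: "set ys = Y" "distinct ys" "length ys = d + 1"
        using finite_distinct_list[of Y] Y finX finite_subset distinct_card by metis
      \<comment> \<open>Interpolate on \<open>X\<close> without its \<open>i\<close>-th chosen point, then combine by near-unanimity.\<close>
      have "\<exists>h. (m, h) \<in> C \<and> (\<forall>x\<in>X - {ys ! i}. h x = f x)" if "i < d + 1" for i
      proof (rule less.hyps)
        have "ys ! i \<in> X" using that ys Y by (metis nth_mem subsetD)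
        then show "card (X - {ys ! i}) < card X" using finX by (rule card_Diff1_less[rotated])
        show "X - {ys ! i} \<subseteq> nlists m A" using less.prems by blast
      qed
      then obtain h where h: "\<And>i. i < d + 1 \<Longrightarrow> (m, h i) \<in> C"
        "\<And>i x. i < d + 1 \<Longrightarrow> x \<in> X - {ys ! i} \<Longrightarrow> h i x = f x" by metis
      define hs where "hs = map h [0..<d + 1]"
      have "composition A m g hs \<in> C"
        using h by (intro composition_in_clone[OF C g(1)]) (auto simp: hs_def simp del: upt_Suc)
      moreover have "snd (composition A m g hs) x = f x" if x: "x \<in> X" for x
      proof -
        have xA: "x \<in> nlists m A" using x less.prems by blast
        then have fx: "f x \<in> A" using f by (auto simp: operations_def)
        obtain j where j: "j < d + 1" "\<And>i. i < d + 1 \<Longrightarrow> i \<noteq> j \<Longrightarrow> x \<noteq> ys ! i"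
        proof (cases "x \<in> set ys")
          case True
          then obtain j where "j < d + 1" "x = ys ! j" using ys by (metis in_set_conv_nth)
          then show ?thesis using that[of j] ys by (metis nth_eq_iff_index_eq)
        next
          case False
          then show ?thesis using that[of 0] ys by (metis nth_mem zero_less_Suc Suc_eq_plus1)
        qed
        have hA: "h j x \<in> A"
          using clone_operationD(2)[OF C h(1)[OF j(1)]] xA by auto
        have "map (\<lambda>k. k x) hs = (replicate (d + 1) (f x))[j := h j x]"
        proof (rule nth_equalityI)
          fix i assume "i < length (map (\<lambda>k. k x) hs)"
          then have i: "i < d + 1" by (simp add: hs_def)
          then show "map (\<lambda>k. k x) hs ! i = (replicate (d + 1) (f x))[j := h j x] ! i"
            using h(2)[OF i, of x] j x
            by (cases "i = j") (auto simp: hs_def nth_list_update simp del: upt_Suc replicate_Suc)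
        qed (simp add: hs_def del: replicate_Suc)
        then have "g (map (\<lambda>k. k x) hs) = f x"
          using g(2) fx hA j(1) unfolding near_unanimity_def by metis
        then show ?thesis using xA by (simp add: composition_def)
      qed
      ultimately show ?thesis unfolding composition_def by (intro exI) auto
    qed
  qed
  from this[OF order_refl] obtain h where h: "(m, h) \<in> C" "\<forall>x\<in>nlists m A. h x = f x" by blast
  have "h \<in> extensional (nlists m A)" "f \<in> extensional (nlists m A)"
    using clone_operationD(2)[OF C h(1)] f by (auto simp: operations_def PiE_def)
  then have "h = f" using h(2) extensionalityI by metis
  then show ?thesis using h by simp
qed

text \<open>
  An operation of any arity \<open>m\<close>, after identification of variables along \<open>u\<close> into \<open>M\<close> variables
  and renaming back along \<open>v\<close>, is generated by the \<open>M\<close>-ary part.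
\<close>

lemma identification_in_Clo:
  assumes C: "is_clone A C" and f: "(m, f) \<in> C"
    and u: "\<And>i. i < m \<Longrightarrow> u i < M" and v: "\<And>j. j < M \<Longrightarrow> v j < m"
  shows "(m, \<lambda>xs\<in>nlists m A. f (map (\<lambda>i. xs ! v (u i)) [0..<m])) \<in> Clo A (arity_part C M)"
proof -
  let ?D = "Clo A (arity_part C M)"
  have D: "is_clone A ?D"
    using C by (intro Clo_is_clone) (auto simp: is_clone_def arity_part_def)
  define f' where "f' = composition A M f (map (\<lambda>i. snd (projection A M (u i))) [0..<m])"
  have pr: "(k, snd (projection A k i)) = projection A k i" for k i
    by (simp add: projection_def)
  have "f' \<in> C" unfolding f'_def
    by (intro composition_in_clone[OF C f]) (auto simp: pr intro!: projection_in_clone[OF C] u)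
  moreover have f'M: "fst f' = M" by (simp add: f'_def composition_def)
  ultimately have "f' \<in> ?D" using Clo_superset[of "arity_part C M" A] by (auto simp: arity_part_def)
  then have f'D: "(M, snd f') \<in> ?D" using f'M by (metis prod.collapse)
  define h where "h = composition A m (snd f') (map (\<lambda>j. snd (projection A m (v j))) [0..<M])"
  have "h \<in> ?D" unfolding h_def
    by (intro composition_in_clone[OF D f'D]) (auto simp: pr intro!: projection_in_clone[OF D] v)
  moreover have "h = (m, \<lambda>xs\<in>nlists m A. f (map (\<lambda>i. xs ! v (u i)) [0..<m]))"
  proof -
    have "snd f' (map (\<lambda>g. g xs) (map (\<lambda>j. snd (projection A m (v j))) [0..<M]))
        = f (map (\<lambda>i. xs ! v (u i)) [0..<m])" if xs: "xs \<in> nlists m A" for xs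
    proof -
      let ?y = "map (\<lambda>j. xs ! v j) [0..<M]"
      have 1: "map (\<lambda>g. g xs) (map (\<lambda>j. snd (projection A m (v j))) [0..<M]) = ?y"
        using xs by (simp add: projection_def)
      have y: "?y \<in> nlists M A"
        using xs v by (auto simp: in_nlists_iff)
      have "map (\<lambda>g. g ?y) (map (\<lambda>i. snd (projection A M (u i))) [0..<m])
          = map (\<lambda>i. xs ! v (u i)) [0..<m]"
        using y u by (simp add: projection_def)
      then show ?thesis unfolding 1 using y
        by (simp only: f'_def composition_def snd_conv restrict_apply')
    qed
    then show ?thesis unfolding h_def composition_def by (auto intro!: restrict_ext)
  qed
  ultimately show ?thesis by simp
qed

theorem generated_by_arity_part:
  assumes fin: "finite A" and C: "is_clone A C"
    and g: "(d + 1, g) \<in> C" "near_unanimity A d g"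
    and M: "d + 1 \<le> M" "card A ^ d \<le> M"
  shows "C = Clo A (arity_part C M)"
proof
  let ?D = "Clo A (arity_part C M)"
  show "?D \<subseteq> C" using C by (intro Clo_least) (auto simp: arity_part_def)
  have D: "is_clone A ?D"
    using C by (intro Clo_is_clone) (auto simp: is_clone_def arity_part_def)
  have gD: "(d + 1, g) \<in> ?D"
  proof -
    \<comment> \<open>No variables of \<open>g\<close> are identified; the superfluous ones are sent to the first.\<close>
    have "(d + 1, \<lambda>xs\<in>nlists (d + 1) A. g (map (\<lambda>i. xs ! (if i < d + 1 then i else 0)) [0..<d + 1]))
        \<in> ?D"
      using identification_in_Clo[OF C g(1), of "\<lambda>i. i" M "\<lambda>j. if j < d + 1 then j else 0"] M
      by simp
    also have "(\<lambda>xs\<in>nlists (d + 1) A. g (map (\<lambda>i. xs ! (if i < d + 1 then i else 0)) [0..<d + 1]))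
        = g"
    proof (rule extensionalityI[of _ "nlists (d + 1) A"])
      show "g \<in> extensional (nlists (d + 1) A)"
        using clone_operationD(2)[OF C g(1)] by (auto simp: PiE_def)
      fix xs assume xs: "xs \<in> nlists (d + 1) A"
      have "map (\<lambda>i. xs ! (if i < d + 1 then i else 0)) [0..<d + 1] = xs"
        using xs by (intro nth_equalityI) (auto simp: in_nlists_iff simp del: upt_Suc)
      then show "(\<lambda>xs\<in>nlists (d + 1) A. g (map (\<lambda>i. xs ! (if i < d + 1 then i else 0)) [0..<d + 1])) xs
          = g xs" using xs by (metis (no_types, lifting) restrict_apply')
    qed simp
    finally show ?thesis .
  qed
  show "C \<subseteq> ?D"
  proof
    fix p assume "p \<in> C"
    then obtain m f where p: "p = (m, f)" and f: "(m, f) \<in> C" by (cases p) auto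
    have m: "1 \<le> m" using clone_operationD[OF C f] by simp
    have "(m, f) \<in> ?D"
    proof (rule baker_pixley[OF fin D gD g(2)])
      show "(m, f) \<in> operations A" using f C by (auto simp: is_clone_def)
      fix X assume X: "X \<subseteq> nlists m A" "card X \<le> d"
      have finL: "finite (nlists m A)"
        using fin by (rule finite_nlists)
      then have finX: "finite X" using X finite_subset by blast
      \<comment> \<open>Variables with equal columns on \<open>X\<close> need not be distinguished.\<close>
      define col where "col i = (\<lambda>x\<in>X. x ! i)" for i
      have sub: "col ` {..<m} \<subseteq> X \<rightarrow>\<^sub>E A"
        using X by (fastforce simp: col_def in_nlists_iff)
      have le: "card (col ` {..<m}) \<le> M"
      proof (cases "X = {}")
        case True
        have "card (col ` {..<m}) \<le> card (X \<rightarrow>\<^sub>E A)"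
          using sub finX fin by (intro card_mono finite_PiE) auto
        then show ?thesis using True M by simp
      next
        case False
        then have "A \<noteq> {}" using X m by (fastforce simp: in_nlists_iff)
        then have "card A \<ge> 1" using fin by (simp add: Suc_leI card_gt_0_iff)
        have "card (col ` {..<m}) \<le> card (X \<rightarrow>\<^sub>E A)"
          using sub finX fin by (intro card_mono finite_PiE) auto
        also have "\<dots> = card A ^ card X" using finX by (simp add: card_PiE)
        also have "\<dots> \<le> card A ^ d" using X \<open>card A \<ge> 1\<close> by (intro power_increasing) auto
        finally show ?thesis using M by simp
      qed
      obtain b where b: "bij_betw b (col ` {..<m}) {0..<card (col ` {..<m})}"
        using ex_bij_betw_finite_nat[of "col ` {..<m}"] by auto
      define u where "u i = b (col i)" for i
      define v where "v j = (if j \<in> u ` {..<m} then inv_into {..<m} u j else 0)" for j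
      have uM: "u i < M" if "i < m" for i
      proof -
        have "u i \<in> {0..<card (col ` {..<m})}"
          unfolding u_def using that by (intro bij_betw_apply[OF b]) simp
        then show ?thesis using le by simp
      qed
      have vm: "v j < m" for j
        using m inv_into_into[of j u "{..<m}"] by (auto simp: v_def)
      have uv: "col (v (u i)) = col i" if "i < m" for i
      proof -
        have "u (v (u i)) = u i" using that by (simp add: v_def f_inv_into_f)
        then show ?thesis using b vm that unfolding u_def
          by (meson bij_betw_imp_inj_on imageI inj_on_eq_iff lessThan_iff)
      qed
      define h where "h = (\<lambda>xs\<in>nlists m A. f (map (\<lambda>i. xs ! v (u i)) [0..<m]))"
      have "(m, h) \<in> ?D" unfolding h_def
        using uM vm by (intro identification_in_Clo[OF C f]) auto
      moreover have "h x = f x" if x: "x \<in> X" for x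
      proof -
        have xA: "x \<in> nlists m A" using x X by blast
        have "x ! v (u i) = x ! i" if "i < m" for i
          using fun_cong[OF uv[OF that], of x] x by (simp add: col_def)
        then have "map (\<lambda>i. x ! v (u i)) [0..<m] = x"
          using xA by (intro nth_equalityI) (auto simp: in_nlists_iff)
        then show ?thesis using xA by (simp add: h_def)
      qed
      ultimately show "\<exists>h. (m, h) \<in> ?D \<and> (\<forall>x\<in>X. h x = f x)" by blast
    qed
    then show "p \<in> ?D" using p by simp
  qed
qed

lemma clone_lambda_le:
  assumes "is_clone A C" "finite A" "(d + 1, g) \<in> C" "near_unanimity A d g"
  shows "clone_lambda A C \<le> d + 1 + card A ^ d"
  unfolding clone_lambda_def
  using generated_by_arity_part[OF assms(2,1,3,4), of "d + 1 + card A ^ d"]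
  by (intro Least_le) simp

lemma clone_lambda_generates:
  assumes "is_clone A C" "finite A" "(d + 1, g) \<in> C" "near_unanimity A d g"
  shows "C = Clo A (arity_part C (clone_lambda A C))"
proof -
  have "1 \<le> d + 1 + card A ^ d \<and> C = Clo A (arity_part C (d + 1 + card A ^ d))"
    using generated_by_arity_part[OF assms(2,1,3,4), of "d + 1 + card A ^ d"] by simp
  from LeastI[of "\<lambda>m. 1 \<le> m \<and> C = Clo A (arity_part C m)", OF this]
  show ?thesis unfolding clone_lambda_def by blast
qed

lemma clone_lambda_le_gamma:
  assumes "C \<in> cons_nu_clones d n"
  shows "clone_lambda {..<n} C \<le> gamma d n"
proof -
  have "{clone_lambda {..<n} C | C. C \<in> cons_nu_clones d n} \<subseteq> {..d + 1 + n ^ d}"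
  proof safe
    fix C assume "C \<in> cons_nu_clones d n"
    then show "clone_lambda {..<n} C \<le> d + 1 + n ^ d"
      unfolding cons_nu_clones_def using clone_lambda_le[of "{..<n}" C d] by auto
  qed
  then have "finite {clone_lambda {..<n} C | C. C \<in> cons_nu_clones d n}"
    using finite_subset by blast
  then show ?thesis unfolding gamma_def using assms by (intro Max_ge) auto
qed

section \<open>The spike relations\<close>

text \<open>
  The spikes, enumerated by \<open>k < d * q\<close>: the quotient of \<open>k\<close> by \<open>q\<close> is the position of the nonzero
  entry, and the remainder plus \<open>2\<close> is its value.
\<close>

definition spike :: "nat \<Rightarrow> nat \<Rightarrow> nat \<Rightarrow> nat \<Rightarrow> nat" where
  "spike d q k = (\<lambda>i\<in>{..<d}. if i = k div q then k mod q + 2 else 0)"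

text \<open>The spikes with index in \<open>K\<close> and the \<open>0\<close>-\<open>1\<close>-tuples other than \<open>(1, \<dots>, 1)\<close>.\<close>

definition spike_rel :: "nat \<Rightarrow> nat \<Rightarrow> nat set \<Rightarrow> (nat \<Rightarrow> nat) set" where
  "spike_rel d q K = {t \<in> {..<d} \<rightarrow>\<^sub>E {0, 1}. \<exists>i<d. t i = 0} \<union> spike d q ` K"

lemma spike_rel_mono: "K \<subseteq> L \<Longrightarrow> spike_rel d q K \<subseteq> spike_rel d q L"
  by (auto simp: spike_rel_def)

lemma spike_rel_PiE:
  assumes "0 < q"
  shows "spike_rel d q K \<subseteq> {..<d} \<rightarrow>\<^sub>E {..<q + 2}"
proof -
  have "{..<d} \<rightarrow>\<^sub>E {0, 1} \<subseteq> {..<d} \<rightarrow>\<^sub>E {..<q + 2}" by (intro PiE_mono) auto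
  moreover have "spike d q k \<in> {..<d} \<rightarrow>\<^sub>E {..<q + 2}" for k
    using assms by (auto simp: spike_def)
  ultimately show ?thesis by (auto simp: spike_rel_def)
qed

lemma spike_rel_has_zero:
  assumes "2 \<le> d" "t \<in> spike_rel d q K"
  shows "\<exists>i<d. t i = 0"
proof (cases "t \<in> spike d q ` K")
  case True
  then obtain k where k: "t = spike d q k" by blast
  define i where "i = (if k div q = 0 then 1 else 0 :: nat)"
  have "i < d" "i \<noteq> k div q" using assms by (auto simp: i_def)
  then have "t i = 0" by (simp add: k spike_def)
  then show ?thesis using \<open>i < d\<close> by blast
qed (use assms in \<open>auto simp: spike_rel_def\<close>)

text \<open>An entry of at least \<open>2\<close>, together with its position, determines a member of the relation.\<close>

lemma spike_rel_large_entry: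
  assumes t: "t \<in> spike_rel d q K" and i: "i < d" and c: "2 \<le> t i" and q: "0 < q"
  shows "i * q + (t i - 2) \<in> K" "t = spike d q (i * q + (t i - 2))"
proof -
  have "t \<notin> {..<d} \<rightarrow>\<^sub>E {0, 1}" using i c PiE_mem[of t "{..<d}" "\<lambda>_. {0, 1}" i] by fastforce
  then obtain k where k: "k \<in> K" "t = spike d q k" using t by (auto simp: spike_rel_def)
  have "i = k div q" using c i by (auto simp: k spike_def split: if_splits)
  moreover from this have "t i - 2 = k mod q" using i by (simp add: k spike_def)
  ultimately have "i * q + (t i - 2) = k" by simp
  then show "i * q + (t i - 2) \<in> K" "t = spike d q (i * q + (t i - 2))" using k by simp_all
qed

lemma spike_rel_large_entry_unique:
  assumes t: "t \<in> spike_rel d q K" and i: "i < d" and c: "2 \<le> t i" and q: "0 < q"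
    and j: "j < d" "j \<noteq> i"
  shows "t j = 0"
proof -
  have "t i < q + 2" using t spike_rel_PiE[OF q, of d K] i by (auto simp: PiE_iff)
  then have "t i - 2 < q" using c by linarith
  then have "(i * q + (t i - 2)) div q = i" using q by (simp only: div_mult_self3) simp
  then show ?thesis
    using j by (subst spike_rel_large_entry(2)[OF t i c q]) (simp add: spike_def)
qed

text \<open>Fewer than \<open>d * q\<close> tuples cannot comprise all spikes.\<close>

lemma preserves_all_spikes:
  assumes "m < d * q"
    and pres: "\<And>k. k < d * q \<Longrightarrow> preserves {..<d} (m, f) (spike_rel d q ({..<d * q} - {k}))"
  shows "preserves {..<d} (m, f) (spike_rel d q {..<d * q})"
  unfolding preserves_def
proof (intro allI impI)
  fix ts assume "length ts = fst (m, f) \<and> set ts \<subseteq> spike_rel d q {..<d * q}"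
  then have l: "length ts = m" and ts: "set ts \<subseteq> spike_rel d q {..<d * q}" by auto
  have "set ts \<inter> spike d q ` {..<d * q} \<subseteq> spike d q ` {..<d * q}" by blast
  then obtain L where L: "L \<subseteq> {..<d * q}" "inj_on (spike d q) L"
    "set ts \<inter> spike d q ` {..<d * q} = spike d q ` L"
    by (auto simp: subset_image_inj)
  have "card L = card (set ts \<inter> spike d q ` {..<d * q})"
    using L card_image by metis
  also have "\<dots> \<le> card (set ts)" by (intro card_mono) auto
  also have "\<dots> \<le> m" using l card_length by blast
  finally have "card L < card {..<d * q}" using assms(1) by simp
  then have "L \<noteq> {..<d * q}" by blast
  then obtain k where k: "k < d * q" "k \<notin> L" using L by blast
  have "set ts \<subseteq> spike_rel d q ({..<d * q} - {k})"
  proof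
    fix t assume "t \<in> set ts"
    show "t \<in> spike_rel d q ({..<d * q} - {k})"
    proof (cases "t \<in> spike d q ` {..<d * q}")
      case True
      then have "t \<in> spike d q ` L" using L \<open>t \<in> set ts\<close> by blast
      then show ?thesis using L k by (auto simp: spike_rel_def)
    next
      case False
      then show ?thesis using ts \<open>t \<in> set ts\<close> unfolding spike_rel_def by blast
    qed
  qed
  from preservesD[OF pres[OF k(1)] l this]
  show "(\<lambda>i\<in>{..<d}. snd (m, f) (map (\<lambda>t. t i) ts)) \<in> spike_rel d q {..<d * q}"
    using spike_rel_mono[of "{..<d * q} - {k}" "{..<d * q}"] by auto
qed

section \<open>An operation that needs all spikes\<close>

text \<open>Row \<open>s\<close> of the matrix whose columns are the spikes.\<close>

definition spike_row :: "nat \<Rightarrow> nat \<Rightarrow> nat \<Rightarrow> nat list" where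
  "spike_row d q s = map (\<lambda>k. spike d q k s) [0..<d * q]"

text \<open>The indicator function of these rows.\<close>

definition witness_op :: "nat \<Rightarrow> nat \<Rightarrow> nat list \<Rightarrow> nat" where
  "witness_op d q =
     (\<lambda>xs\<in>nlists (d * q) {..<q + 2}. if xs \<in> spike_row d q ` {..<d} then 1 else 0)"

lemma spike_row_nlists: "0 < q \<Longrightarrow> s < d \<Longrightarrow> spike_row d q s \<in> nlists (d * q) {..<q + 2}"
  by (auto simp: spike_row_def in_nlists_iff spike_def)

lemma witness_op_spikes: "0 < q \<Longrightarrow> s < d \<Longrightarrow> witness_op d q (spike_row d q s) = 1"
  using spike_row_nlists[of q s d] by (auto simp: witness_op_def)

lemma witness_op_preserves:
  assumes q: "0 < q" and k: "k < d * q"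
  shows "preserves {..<d} (d * q, witness_op d q) (spike_rel d q ({..<d * q} - {k}))"
  unfolding preserves_def
proof (intro allI impI)
  let ?R = "spike_rel d q ({..<d * q} - {k})"
  fix ts assume "length ts = fst (d * q, witness_op d q) \<and> set ts \<subseteq> ?R"
  then have l: "length ts = d * q" and ts: "set ts \<subseteq> ?R" by auto
  have row: "map (\<lambda>t. t i) ts \<in> nlists (d * q) {..<q + 2}" if "i < d" for i
    using that by (intro row_in_nlists[OF spike_rel_PiE[OF q] ts l]) simp
  let ?r = "\<lambda>i\<in>{..<d}. snd (d * q, witness_op d q) (map (\<lambda>t. t i) ts)"
  have r01: "?r \<in> {..<d} \<rightarrow>\<^sub>E {0, 1}"
    using row by (auto simp: witness_op_def)
  \<comment> \<open>In the coordinate of the omitted spike, the value \<open>1\<close> would force that spike into \<open>ts\<close>.\<close>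
  define i where "i = k div q"
  have i: "i < d" using k q by (simp add: i_def less_mult_imp_div_less)
  have "?r i = 0"
  proof (rule ccontr)
    assume "?r i \<noteq> 0"
    then obtain s where s: "s < d" "map (\<lambda>t. t i) ts = spike_row d q s"
      using i row by (auto simp: witness_op_def split: if_splits)
    define p where "p = s * q + k mod q"
    have pd: "p div q = s" "p mod q = k mod q" using q by (simp_all add: p_def)
    have p: "p < d * q"
    proof -
      have "p < s * q + q" using q by (simp add: p_def)
      also have "\<dots> = Suc s * q" by simp
      also have "\<dots> \<le> d * q" using s by (intro mult_right_mono) auto
      finally show ?thesis .
    qed
    have "(ts ! p) i = map (\<lambda>t. t i) ts ! p" using p l by simp
    also have "\<dots> = spike d q p s" using s p by (simp add: spike_row_def)
    also have "\<dots> = k mod q + 2" using s pd by (simp add: spike_def)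
    finally have e: "(ts ! p) i = k mod q + 2" .
    have "ts ! p \<in> ?R" using ts p l by auto
    from spike_rel_large_entry(1)[OF this i _ q] e have "i * q + k mod q \<noteq> k" by simp
    then show False by (simp add: i_def)
  qed
  then show "?r \<in> ?R" using r01 i unfolding spike_rel_def by blast
qed

section \<open>A conservative near-unanimity operation\<close>

text \<open>All entries but possibly one are equal to \<open>a\<close>.\<close>

definition nearly :: "'a \<Rightarrow> 'a list \<Rightarrow> bool" where
  "nearly a xs \<longleftrightarrow> (\<exists>i<length xs. \<forall>j<length xs. j \<noteq> i \<longrightarrow> xs ! j = a)"

text \<open>
  The nearly unanimous value if there is one. Otherwise \<open>0\<close> is preferred to \<open>1\<close>, and \<open>1\<close> to all
  other values.
\<close>

definition cons_nu :: "nat list \<Rightarrow> nat" where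
  "cons_nu xs = (if \<exists>a. nearly a xs then THE a. nearly a xs
     else if 0 \<in> set xs then 0 else if 1 \<in> set xs then 1 else hd xs)"

lemma nearly_unique:
  assumes "nearly a xs" "nearly b xs" "3 \<le> length xs"
  shows "a = b"
proof -
  obtain i i' where i: "\<forall>j<length xs. j \<noteq> i \<longrightarrow> xs ! j = a" "\<forall>j<length xs. j \<noteq> i' \<longrightarrow> xs ! j = b"
    using assms by (auto simp: nearly_def)
  define j where "j = (if 0 \<notin> {i, i'} then 0 else if 1 \<notin> {i, i'} then 1 else 2 :: nat)"
  have "j < 3" "j \<noteq> i" "j \<noteq> i'" by (auto simp: j_def)
  moreover from this have "j < length xs" using assms(3) by simp
  ultimately have "xs ! j = a" "xs ! j = b" using i by blast+
  then show ?thesis by simp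
qed

lemma cons_nu_nearly: "nearly a xs \<Longrightarrow> 3 \<le> length xs \<Longrightarrow> cons_nu xs = a"
  unfolding cons_nu_def using nearly_unique by (metis (mono_tags, lifting) the_equality)

lemma nearly_in_set:
  assumes "nearly a xs" "3 \<le> length xs"
  shows "a \<in> set xs"
proof -
  obtain i where i: "\<forall>j<length xs. j \<noteq> i \<longrightarrow> xs ! j = a" using assms by (auto simp: nearly_def)
  define j where "j = (if i = 0 then 1 else 0 :: nat)"
  have "j < length xs" "j \<noteq> i" using assms(2) by (auto simp: j_def)
  then show ?thesis using i by (metis nth_mem)
qed

lemma cons_nu_in_set:
  assumes "3 \<le> length xs"
  shows "cons_nu xs \<in> set xs"
proof (cases "\<exists>a. nearly a xs")
  case True
  then show ?thesis using cons_nu_nearly nearly_in_set assms by metis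
next
  case False
  moreover have "xs \<noteq> []" using assms by auto
  ultimately show ?thesis by (simp add: cons_nu_def)
qed

lemma nearly_map:
  "nearly t ts \<Longrightarrow> nearly (f t) (map f ts)"
  by (auto simp: nearly_def)

lemma cons_nu_preserves:
  assumes d: "2 \<le> d" and q: "0 < q"
  shows "preserves {..<d} (d + 1, \<lambda>xs\<in>nlists (d + 1) {..<q + 2}. cons_nu xs) (spike_rel d q K)"
  unfolding preserves_def
proof (intro allI impI)
  let ?R = "spike_rel d q K" and ?g = "(d + 1, \<lambda>xs\<in>nlists (d + 1) {..<q + 2}. cons_nu xs)"
  fix ts assume "length ts = fst ?g \<and> set ts \<subseteq> ?R"
  then have l: "length ts = d + 1" and ts: "set ts \<subseteq> ?R" by auto
  define row where "row i = map (\<lambda>t. t i) ts" for i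
  have lr: "3 \<le> length (row i)" "length (row i) = d + 1" for i using l d by (auto simp: row_def)
  have "row i \<in> nlists (d + 1) {..<q + 2}" if "i < d" for i
    unfolding row_def using that by (intro row_in_nlists[OF spike_rel_PiE[OF q] ts l]) simp
  then have r: "(\<lambda>i\<in>{..<d}. snd ?g (map (\<lambda>t. t i) ts)) = (\<lambda>i\<in>{..<d}. cons_nu (row i))"
    by (intro restrict_ext) (auto simp: row_def)
  have res: "(\<lambda>i\<in>{..<d}. t i) = t" if "t \<in> set ts" for t
    using that ts spike_rel_PiE[OF q, of d K]
      PiE_restrict[of t "{..<d}" "\<lambda>_. {..<q + 2}"] by blast
  have "(\<lambda>i\<in>{..<d}. cons_nu (row i)) \<in> ?R"
  proof (cases "\<exists>i<d. 2 \<le> cons_nu (row i)")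
    case True
    then obtain i where i: "i < d" and c: "2 \<le> cons_nu (row i)" by blast
    \<comment> \<open>Here the result is one of the arguments.\<close>
    have "\<exists>t\<in>set ts. \<forall>j<d. cons_nu (row j) = t j"
    proof (cases "\<exists>a. nearly a (row i)")
      case True
      then have near: "nearly (cons_nu (row i)) (row i)" using cons_nu_nearly lr by metis
      define t where "t = spike d q (i * q + (cons_nu (row i) - 2))"
      obtain p where p: "p < d + 1" "\<And>j. j < d + 1 \<Longrightarrow> j \<noteq> p \<Longrightarrow> row i ! j = cons_nu (row i)"
        using near lr unfolding nearly_def by auto
      have "ts ! j = t" if "j < d + 1" "j \<noteq> p" for j
      proof -
        have "(ts ! j) i = cons_nu (row i)" using p(2)[OF that] that l by (simp add: row_def)
        then show ?thesis unfolding t_def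
          using spike_rel_large_entry(2)[of "ts ! j" d q K i] ts that l i q c
          by (metis nth_mem subsetD)
      qed
      then have nt: "nearly t ts" using p(1) l unfolding nearly_def by auto
      then have "t \<in> set ts" using l d by (intro nearly_in_set) auto
      moreover have "cons_nu (row j) = t j" for j
        using nearly_map[OF nt, of "\<lambda>t. t j"] cons_nu_nearly lr unfolding row_def by blast
      ultimately show ?thesis by blast
    next
      case False
      then have no: "0 \<notin> set (row i)" "1 \<notin> set (row i)" "cons_nu (row i) = hd (row i)"
        using c by (auto simp: cons_nu_def split: if_splits)
      have zero: "t j = 0" if "t \<in> set ts" "j < d" "j \<noteq> i" for t j
      proof -
        have "t i \<in> set (row i)" using that by (simp add: row_def)
        then have "t i \<noteq> 0" "t i \<noteq> 1" using no by metis+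
        then have "2 \<le> t i" by simp
        then show ?thesis using spike_rel_large_entry_unique that ts i q by blast
      qed
      have ne: "ts \<noteq> []" using l by auto
      have "cons_nu (row j) = hd ts j" if "j < d" for j
      proof (cases "j = i")
        case True
        then show ?thesis using no ne by (simp add: row_def hd_map)
      next
        case False
        have "cons_nu (row j) \<in> set (row j)" using cons_nu_in_set lr by blast
        then have "cons_nu (row j) = 0" using zero that False by (auto simp: row_def)
        then show ?thesis using zero[OF hd_in_set[OF ne] that False] by simp
      qed
      then show ?thesis using ne by (meson hd_in_set)
    qed
    then obtain t where t: "t \<in> set ts" "\<forall>j<d. cons_nu (row j) = t j" by blast
    then have "(\<lambda>i\<in>{..<d}. cons_nu (row i)) = t"
      using res[OF t(1)] by (metis (no_types, lifting) lessThan_iff restrict_ext)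
    then show ?thesis using t ts by auto
  next
    case False
    then have "cons_nu (row i) \<in> {0, 1}" if "i < d" for i using that by force
    then have r01: "(\<lambda>i\<in>{..<d}. cons_nu (row i)) \<in> {..<d} \<rightarrow>\<^sub>E {0, 1}" by auto
    have "\<exists>i<d. cons_nu (row i) = 0"
    proof (rule ccontr)
      assume none: "\<not> (\<exists>i<d. cons_nu (row i) = 0)"
      \<comment> \<open>Each argument has a zero, so that two of them share a zero coordinate.\<close>
      have "\<forall>j<d + 1. \<exists>i<d. (ts ! j) i = 0"
        using spike_rel_has_zero[OF d] ts l by (metis nth_mem subsetD)
      then obtain z where z: "\<And>j. j < d + 1 \<Longrightarrow> z j < d \<and> (ts ! j) (z j) = 0" by metis
      have "\<not> inj_on z {..<d + 1}"
      proof
        assume "inj_on z {..<d + 1}"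
        then have "card {..<d + 1} \<le> card {..<d}" using z by (intro card_inj_on_le[of z]) auto
        then show False by simp
      qed
      then obtain j j' where j: "j < d + 1" "j' < d + 1" "j \<noteq> j'" "z j = z j'"
        by (auto simp: inj_on_def)
      define i where "i = z j"
      have i: "i < d" "row i ! j = 0" "row i ! j' = 0"
        using z[OF j(1)] z[OF j(2)] j l by (auto simp: i_def row_def)
      have nz: "cons_nu (row i) \<noteq> 0" using none i(1) by auto
      have "0 \<in> set (row i)" using i j lr by (metis nth_mem)
      then obtain a where a: "nearly a (row i)" using nz unfolding cons_nu_def by metis
      then have "a = 0" using i j lr unfolding nearly_def by metis
      then show False using nz cons_nu_nearly[OF a lr(1)] by simp
    qed
    then show ?thesis using r01 unfolding spike_rel_def by auto
  qed
  then show "(\<lambda>i\<in>{..<d}. snd ?g (map (\<lambda>t. t i) ts)) \<in> ?R" using r by simp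
qed

lemma near_unanimity_cons_nu:
  assumes "2 \<le> d"
  shows "near_unanimity A d (\<lambda>xs\<in>nlists (d + 1) A. cons_nu xs)"
    and "conservative A (d + 1, \<lambda>xs\<in>nlists (d + 1) A. cons_nu xs)"
proof -
  have mem: "cons_nu xs \<in> set xs" if "xs \<in> nlists (d + 1) A" for xs
    using that assms by (intro cons_nu_in_set) (auto simp: in_nlists_iff)
  moreover have "cons_nu xs \<in> A" if "xs \<in> nlists (d + 1) A" for xs
    using that mem unfolding in_nlists_iff by blast
  moreover have "cons_nu ((replicate (d + 1) x)[i := y]) = x" if "i < d + 1" for x y i
    using that assms
    by (intro cons_nu_nearly) (auto simp: nearly_def nth_list_update simp del: replicate_Suc)
  moreover have "(replicate (d + 1) x)[i := y] \<in> nlists (d + 1) A" if "x \<in> A" "y \<in> A" for x y i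
    using that set_update_subset_insert[of "replicate (d + 1) x" i y]
    by (fastforce simp: in_nlists_iff)
  ultimately show "near_unanimity A d (\<lambda>xs\<in>nlists (d + 1) A. cons_nu xs)"
    and "conservative A (d + 1, \<lambda>xs\<in>nlists (d + 1) A. cons_nu xs)"
    by (auto simp: near_unanimity_def conservative_def operations_def simp del: replicate_Suc)
qed

section \<open>The lower bound\<close>

text \<open>The clone of the operations that preserve the relations in which exactly one spike is missing.\<close>

definition spike_clone :: "nat \<Rightarrow> nat \<Rightarrow> nat operation set" where
  "spike_clone d q =
     Pol {..<q + 2} {..<d} ((\<lambda>k. spike_rel d q ({..<d * q} - {k})) ` {..<d * q})"

lemma spike_clone_is_clone: "0 < q \<Longrightarrow> is_clone {..<q + 2} (spike_clone d q)"
  unfolding spike_clone_def using spike_rel_PiE[of q d] by (intro Pol_is_clone) auto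

lemma cons_nu_in_spike_clone:
  assumes "2 \<le> d" "0 < q"
  shows "(d + 1, \<lambda>xs\<in>nlists (d + 1) {..<q + 2}. cons_nu xs) \<in> spike_clone d q"
  using cons_nu_preserves[OF assms] near_unanimity_cons_nu(1)[OF assms(1), of "{..<q + 2}"]
  by (auto simp: spike_clone_def Pol_def near_unanimity_def)

lemma spike_clone_in_cons_nu_clones:
  assumes "2 \<le> d" "0 < q"
  shows "spike_clone d q \<in> cons_nu_clones d (q + 2)"
  unfolding cons_nu_clones_def
  using spike_clone_is_clone[OF assms(2)] cons_nu_in_spike_clone[OF assms]
    near_unanimity_cons_nu[OF assms(1)]
  by blast

lemma witness_op_in_spike_clone:
  assumes "2 \<le> d" "0 < q"
  shows "(d * q, witness_op d q) \<in> spike_clone d q"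
proof -
  have "(d * q, witness_op d q) \<in> operations {..<q + 2}"
    using assms by (auto simp: operations_def witness_op_def)
  then show ?thesis using witness_op_preserves[OF assms(2)] by (auto simp: spike_clone_def Pol_def)
qed

lemma witness_op_not_preserves_all_spikes:
  assumes d: "2 \<le> d" and q: "0 < q"
  shows "\<not> preserves {..<d} (d * q, witness_op d q) (spike_rel d q {..<d * q})"
proof
  let ?ts = "map (spike d q) [0..<d * q]" and ?R = "spike_rel d q {..<d * q}"
  assume "preserves {..<d} (d * q, witness_op d q) ?R"
  then have mem: "(\<lambda>i\<in>{..<d}. witness_op d q (map (\<lambda>t. t i) ?ts)) \<in> ?R"
    by (rule preservesD) (auto simp: spike_rel_def)
  have "map (\<lambda>t. t i) ?ts = spike_row d q i" for i
    by (simp add: spike_row_def)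
  then show False
    using spike_rel_has_zero[OF d mem] witness_op_spikes[OF q] by auto
qed

lemma small_arity_generates_Pol:
  assumes q: "0 < q" and m: "m < d * q"
  shows "Clo {..<q + 2} (arity_part (spike_clone d q) m)
    \<subseteq> Pol {..<q + 2} {..<d} {spike_rel d q {..<d * q}}"
proof (rule Clo_least)
  show "is_clone {..<q + 2} (Pol {..<q + 2} {..<d} {spike_rel d q {..<d * q}})"
    using spike_rel_PiE[OF q] by (intro Pol_is_clone) auto
  show "arity_part (spike_clone d q) m \<subseteq> Pol {..<q + 2} {..<d} {spike_rel d q {..<d * q}}"
  proof
    fix p assume "p \<in> arity_part (spike_clone d q) m"
    then obtain f where p: "p = (m, f)" "(m, f) \<in> spike_clone d q"
      by (cases p) (auto simp: arity_part_def)
    then have "preserves {..<d} (m, f) (spike_rel d q {..<d * q})"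
      by (intro preserves_all_spikes[OF m]) (auto simp: spike_clone_def Pol_def)
    then show "p \<in> Pol {..<q + 2} {..<d} {spike_rel d q {..<d * q}}"
      using p by (auto simp: spike_clone_def Pol_def)
  qed
qed

lemma clone_lambda_spike_clone:
  assumes d: "2 \<le> d" and q: "0 < q"
  shows "d * q \<le> clone_lambda {..<q + 2} (spike_clone d q)"
proof (rule leI, rule notI)
  let ?m = "clone_lambda {..<q + 2} (spike_clone d q)"
  assume "?m < d * q"
  from small_arity_generates_Pol[OF q this]
  have "spike_clone d q \<subseteq> Pol {..<q + 2} {..<d} {spike_rel d q {..<d * q}}"
    using clone_lambda_generates[OF spike_clone_is_clone[OF q] _ cons_nu_in_spike_clone[OF d q]
        near_unanimity_cons_nu(1)[OF d]] by simp
  then show False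
    using witness_op_in_spike_clone[OF d q] witness_op_not_preserves_all_spikes[OF d q]
    unfolding Pol_def by blast
qed

theorem theorem4p1:
  fixes n d :: nat
  assumes "n \<ge> 3" and "d \<ge> 3"
  shows "gamma d n \<ge> d * (n - 2)"
proof -
  have d: "2 \<le> d" and q: "0 < n - 2" and n: "n - 2 + 2 = n" using assms by simp_all
  have "d * (n - 2) \<le> clone_lambda {..<n} (spike_clone d (n - 2))"
    using clone_lambda_spike_clone[OF d q] unfolding n .
  also have "\<dots> \<le> gamma d n"
    using spike_clone_in_cons_nu_clones[OF d q] unfolding n by (rule clone_lambda_le_gamma)
  finally show ?thesis .
qed

end
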